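(* Let $A_1,\dots,A_m\in\mathbb{S}^n$ satisfy $\operatorname{tr}A_i=0$ and $\operatorname{tr}(A_iA_j)=\delta_{ij}$ for all $i,j=1,\dots,m$, let $\mathbf{b}\in\mathbb{R}^m$, and let $f(\mathbf{y})=\log\operatorname{tr}\exp A(\mathbf{y})-\mathbf{b}^T\mathbf{y}$ for $\mathbf{y}\in\mathbb{R}^m$. Then $f$ is $\tfrac12$-smooth, i.e. $\nabla^2 f(\mathbf{y})\preceq\tfrac12 I_m$ for all $\mathbf{y}\in\mathbb{R}^m$.
   Context: $\mathbb{S}^n$ is the space of real symmetric $n\times n$ matrices. $\delta_{ij}$ equals $1$ if $i=j$ and $0$ otherwise. $A(\mathbf{y})=\sum_{i=1}^m y_iA_i$. The function $f$ is smooth and convex on $\mathbb{R}^m$; it is called $\lambda$-smooth if $\nabla^2 f(\mathbf{y})\preceq\lambda I_m$ for all $\mathbf{y}\in\mathbb{R}^m$. *)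

theory Defs
  imports "HOL-Analysis.Analysis"
begin

text \<open>The type \<open>real^'n^'n\<close> carries a componentwise multiplication, so the overloaded power
  \<open>^\<close> is not the matrix power; the latter is built from \<open>**\<close>.\<close>

primrec matrix_power :: "real^'n^'n \<Rightarrow> nat \<Rightarrow> real^'n^'n" where
  "matrix_power X 0 = mat 1"
| "matrix_power X (Suc k) = X ** matrix_power X k"

definition matrix_exponential :: "real^'n^'n \<Rightarrow> real^'n^'n" where
  "matrix_exponential X = (\<Sum>k. (1 / fact k) *\<^sub>R matrix_power X k)"

definition symmetric_matrix :: "real^'n^'n \<Rightarrow> bool" where
  "symmetric_matrix X \<longleftrightarrow> transpose X = X"

definition pos_semidef :: "real^'n^'n \<Rightarrow> bool" where
  "pos_semidef X \<longleftrightarrow> symmetric_matrix X \<and> (\<forall>v. 0 \<le> v \<bullet> (X *v v))"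

definition loewner_le :: "real^'n^'n \<Rightarrow> real^'n^'n \<Rightarrow> bool"  (infix "\<preceq>\<^sub>L" 50) where
  "X \<preceq>\<^sub>L Y \<longleftrightarrow> pos_semidef (Y - X)"

definition gradient :: "(real^'m \<Rightarrow> real) \<Rightarrow> real^'m \<Rightarrow> real^'m" where
  "gradient f y = (\<chi> i. frechet_derivative f (at y) (axis i 1))"

definition hessian :: "(real^'m \<Rightarrow> real) \<Rightarrow> real^'m \<Rightarrow> real^'m^'m" where
  "hessian f y = matrix (frechet_derivative (gradient f) (at y))"

definition twice_differentiable :: "(real^'m \<Rightarrow> real) \<Rightarrow> bool" where
  "twice_differentiable f \<longleftrightarrow>
     (\<forall>y. f differentiable at y) \<and> (\<forall>y. gradient f differentiable at y)"

text \<open>Since \<^const>\<open>frechet_derivative\<close> is total, the Hessian is meaningful only for a twice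
  differentiable function, hence the first conjunct.\<close>

definition lambda_smooth :: "real \<Rightarrow> (real^'m \<Rightarrow> real) \<Rightarrow> bool" where
  "lambda_smooth c f \<longleftrightarrow>
     twice_differentiable f \<and> (\<forall>y. hessian f y \<preceq>\<^sub>L c *\<^sub>R mat 1)"

definition lin_comb :: "('m::finite \<Rightarrow> real^'n^'n) \<Rightarrow> real^'m \<Rightarrow> real^'n^'n" where
  "lin_comb A y = (\<Sum>i\<in>UNIV. (y $ i) *\<^sub>R A i)"

end

theory Submission
  imports Defs
begin

text \<open>
  The Hessian of \<open>f\<close> at \<open>y\<close>, evaluated at \<open>v\<close>, is the second derivative of \<open>ln (tr (exp X))\<close> at
  \<open>X = A(y)\<close> in the direction \<open>H = A(v)\<close>. Since the \<open>A i\<close> are orthonormal for the trace inner product,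
  \<open>v \<bullet> v = tr (H\<^sup>2)\<close>, so it suffices to bound this second derivative by \<open>tr (H\<^sup>2) / 2\<close>.

  In an orthonormal eigenbasis of \<open>X\<close>, with eigenvalues \<open>\<lambda>\<^sub>u\<close>, let \<open>h\<^sub>u\<^sub>v\<close> be the entries of \<open>H\<close> and let
  \<open>p\<^sub>u = exp \<lambda>\<^sub>u / Z\<close> with \<open>Z = tr (exp X)\<close>; these are probability weights. The derivative of the
  exponential multiplies \<open>h\<^sub>u\<^sub>v\<close> by the divided difference \<open>\<phi>(\<lambda>\<^sub>u, \<lambda>\<^sub>v)\<close> of \<open>exp\<close>
  (\<open>inner_matrix_exp_deriv_eigenvectors\<close>), so the second derivative of \<open>ln (tr (exp X))\<close> is
  \<open>\<Sum>\<^bsub>u, v\<^esub> \<phi>(\<lambda>\<^sub>u, \<lambda>\<^sub>v) / Z * h\<^sub>u\<^sub>v\<^sup>2 - (\<Sum>\<^bsub>u\<^esub> p\<^sub>u h\<^sub>u\<^sub>u)\<^sup>2\<close>.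
  Convexity of \<open>exp\<close> gives \<open>\<phi>(\<lambda>\<^sub>u, \<lambda>\<^sub>v) / Z \<le> (p\<^sub>u + p\<^sub>v) / 2\<close> (\<open>exp_divdiff_le_mean\<close>). For \<open>u \<noteq> v\<close>
  this is at most \<open>1/2\<close>, so the off-diagonal part is bounded as required. The diagonal part and the
  subtracted square form the variance of \<open>h\<^sub>u\<^sub>u\<close> under \<open>p\<close>, which is at most
  \<open>\<Sum>\<^bsub>u\<^esub> h\<^sub>u\<^sub>u\<^sup>2 / 2\<close> (\<open>variance_le_half_sum_squares\<close>). The two parts add up to
  \<open>tr (H\<^sup>2) / 2\<close> (\<open>quadratic_form_minus_square_le\<close>).

  Two foundations carry this computation: the spectral theorem for symmetric matrices
  (\<open>symmetric_matrix_has_eigenbasis\<close>) and the differentiability of the matrix exponential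
  (\<open>has_derivative_matrix_exponential\<close>). The latter also supplies the twice differentiability of \<open>f\<close>.
\<close>

section \<open>Orthonormal eigenbases of symmetric matrices\<close>

lemma symmetric_matrix_inner:
  assumes "symmetric_matrix X"
  shows "(X *v x) \<bullet> y = x \<bullet> (X *v y)"
  using assms by (metis dot_lmul_matrix symmetric_matrix_def vector_transpose_matrix)

text \<open>A maximizer of the Rayleigh quotient over the unit sphere of \<open>W\<close>, which exists by
  compactness, is an eigenvector by the first-order condition. Restricting to an invariant subspace
  lets the lemma be applied to the orthogonal complement of the eigenvectors already found.\<close>
lemma symmetric_eigenvector_in_invariant_subspace:
  fixes X :: "real^'n^'n"
  assumes sym: "symmetric_matrix X" and W: "subspace W"
    and inv: "\<And>w. w \<in> W \<Longrightarrow> X *v w \<in> W" and nontriv: "\<exists>w\<in>W. w \<noteq> 0"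
  shows "\<exists>u\<in>W. norm u = 1 \<and> X *v u = (u \<bullet> (X *v u)) *\<^sub>R u"
proof -
  let ?S = "sphere 0 1 \<inter> W" and ?q = "\<lambda>v. v \<bullet> (X *v v)"
  obtain w where w: "w \<in> W" "w \<noteq> 0" using nontriv by blast
  have "w /\<^sub>R norm w \<in> ?S"
    using w W by (auto simp: subspace_scale)
  moreover have "compact ?S"
    by (intro compact_Int_closed compact_sphere closed_subspace W)
  moreover have "continuous_on ?S ?q"
    by (intro continuous_intros linear_continuous_on linear_conv_bounded_linear[THEN iffD1]) simp
  ultimately obtain u where u: "u \<in> ?S" and max: "\<And>v. v \<in> ?S \<Longrightarrow> ?q v \<le> ?q u"
    using continuous_attains_sup[of ?S ?q] by blast
  define m where "m = ?q u"
  have uu: "u \<bullet> u = 1" and uW: "u \<in> W"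
    using u by (auto simp: norm_eq_sqrt_inner)
  have bound: "?q v \<le> m * (v \<bullet> v)" if "v \<in> W" for v
  proof (cases "v = 0")
    case False
    then have "v /\<^sub>R norm v \<in> ?S" using that W by (auto simp: subspace_scale)
    from max[OF this] have "?q v / (norm v)\<^sup>2 \<le> m"
      using False by (simp add: m_def matrix_vector_mult_scaleR power2_eq_square field_simps)
    then show ?thesis using False
      by (simp add: divide_le_eq power2_norm_eq_inner)
  qed simp
  define r where "r = m *\<^sub>R u - X *v u"
  have rW: "r \<in> W" unfolding r_def by (intro subspace_diff subspace_scale W uW inv)
  \<comment> \<open>The form \<open>m (v \<bullet> v) - v \<bullet> X v\<close> is nonnegative on \<open>W\<close> and vanishes at \<open>u\<close>, so its
    derivative at \<open>u\<close> in the direction of the residual \<open>r\<close> vanishes.\<close>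
  have quad: "0 \<le> 2 * t * (r \<bullet> r) + t\<^sup>2 * (m * (r \<bullet> r) - ?q r)" for t
  proof -
    have "u + t *\<^sub>R r \<in> W" by (intro subspace_add subspace_scale W uW rW)
    note b = bound[OF this]
    have e1: "?q (u + t *\<^sub>R r) = m + 2 * t * (r \<bullet> (X *v u)) + t\<^sup>2 * ?q r"
      using symmetric_matrix_inner[OF sym, of u r]
      by (simp add: m_def matrix_vector_right_distrib matrix_vector_mult_scaleR inner_add_left
          inner_add_right power2_eq_square algebra_simps inner_commute)
    have e2: "(u + t *\<^sub>R r) \<bullet> (u + t *\<^sub>R r) = 1 + 2 * t * (r \<bullet> u) + t\<^sup>2 * (r \<bullet> r)"
      by (simp add: uu inner_add_left inner_add_right power2_eq_square algebra_simps inner_commute)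
    have e3: "r \<bullet> r = m * (r \<bullet> u) - r \<bullet> (X *v u)"
      by (subst (2) r_def) (simp add: inner_diff_right)
    show ?thesis using b unfolding e1 e2 using arg_cong[OF e3, of "\<lambda>z. 2 * t * z"]
      by (simp add: algebra_simps)
  qed
  have "r \<bullet> r = 0"
  proof (rule ccontr)
    assume "r \<bullet> r \<noteq> 0"
    then have p: "r \<bullet> r > 0" by simp
    define c where "c = m * (r \<bullet> r) - ?q r"
    have c0: "c \<ge> 0" using bound[OF rW] by (simp add: c_def)
    \<comment> \<open>The linear term dominates for small negative \<open>t\<close>; dividing by \<open>c + 1\<close> rather than \<open>c\<close>
      covers \<open>c = 0\<close>.\<close>
    define t where "t = - (r \<bullet> r) / (c + 1)"
    have t0: "t < 0" using p c0 by (simp add: t_def field_simps)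
    have "0 \<le> t * (2 * (r \<bullet> r) + t * c)"
      using quad[of t] by (simp add: c_def[symmetric] power2_eq_square algebra_simps)
    then have "2 * (r \<bullet> r) + t * c \<le> 0"
      using t0 by (simp add: zero_le_mult_iff)
    moreover have "t * c \<ge> - (r \<bullet> r)"
      using p c0 by (simp add: t_def field_simps)
    ultimately show False using p by simp
  qed
  then have "X *v u = m *\<^sub>R u" by (simp add: r_def)
  with u show ?thesis by (auto simp: m_def)
qed

text \<open>A set of vectors rather than an indexed family, so that sums over a basis need no enumeration.\<close>
definition orthonormal_basis :: "(real^'n) set \<Rightarrow> bool" where
  "orthonormal_basis B \<longleftrightarrow>
     finite B \<and> pairwise orthogonal B \<and> (\<forall>u\<in>B. norm u = 1) \<and> span B = UNIV"

text \<open>The eigenvalue of a unit vector \<open>u\<close> is its Rayleigh quotient \<open>u \<bullet> (X *v u)\<close>, so the eigenvalues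
  need not be carried along as separate data.\<close>
definition eigenbasis :: "real^'n^'n \<Rightarrow> (real^'n) set \<Rightarrow> bool" where
  "eigenbasis X B \<longleftrightarrow> orthonormal_basis B \<and> (\<forall>u\<in>B. X *v u = (u \<bullet> (X *v u)) *\<^sub>R u)"

text \<open>An orthonormal set of eigenvectors of maximal size spans: otherwise its orthogonal complement
  is a nonzero subspace, invariant because \<open>X\<close> is symmetric, and it contains one more unit
  eigenvector.\<close>
theorem symmetric_matrix_has_eigenbasis:
  fixes X :: "real^'n^'n"
  assumes sym: "symmetric_matrix X"
  shows "\<exists>B. eigenbasis X B"
proof -
  define P where "P B \<longleftrightarrow> pairwise orthogonal B \<and>
      (\<forall>u\<in>B. norm u = 1 \<and> X *v u = (u \<bullet> (X *v u)) *\<^sub>R u)" for B :: "(real^'n) set"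
  have fin: "finite B \<and> card B \<le> DIM(real^'n)" if "P B" for B
  proof -
    have "independent B"
      using that by (intro pairwise_orthogonal_independent) (auto simp: P_def)
    then show ?thesis using independent_bound by blast
  qed
  have "P {}" by (simp add: P_def)
  then obtain B where B: "P B" and max: "\<And>C. P C \<Longrightarrow> card C \<le> card B"
    using fin ex_has_greatest_nat[of P "{}" card "Suc (DIM(real^'n))"] le_imp_less_Suc by blast
  have "span B = UNIV"
  proof (rule ccontr)
    assume "span B \<noteq> UNIV"
    then obtain w where w: "w \<noteq> 0" "\<And>x. x \<in> span B \<Longrightarrow> orthogonal w x"
      using orthogonal_to_subspace_exists_gen[of B UNIV] by (auto simp: span_UNIV)
    define W where "W = {v. \<forall>u\<in>B. u \<bullet> v = 0}"
    have "subspace W" by (auto simp: subspace_def W_def inner_add_right)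
    moreover have "X *v v \<in> W" if "v \<in> W" for v
      unfolding W_def
    proof (intro CollectI ballI)
      fix u assume "u \<in> B"
      then have "X *v u = (u \<bullet> (X *v u)) *\<^sub>R u" "u \<bullet> v = 0"
        using B that by (auto simp: P_def W_def)
      then have "(X *v u) \<bullet> v = 0" by (metis inner_scaleR_left mult_zero_right)
      then show "u \<bullet> (X *v v) = 0" by (simp add: symmetric_matrix_inner[OF sym])
    qed
    moreover have "\<exists>v\<in>W. v \<noteq> 0"
    proof (intro bexI)
      show "w \<in> W" using w(2)[OF span_base] by (auto simp: W_def orthogonal_def inner_commute)
    qed (rule w(1))
    ultimately obtain v where v: "v \<in> W" "norm v = 1" "X *v v = (v \<bullet> (X *v v)) *\<^sub>R v"
      using symmetric_eigenvector_in_invariant_subspace[OF sym] by blast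
    have "v \<notin> B" using v by (auto simp: W_def)
    have "P (insert v B)"
      using B v by (auto simp: P_def W_def pairwise_insert orthogonal_def inner_commute)
    then show False using max[of "insert v B"] fin[OF B] \<open>v \<notin> B\<close> by simp
  qed
  then have "eigenbasis X B"
    using B fin[OF B] by (auto simp: eigenbasis_def orthonormal_basis_def P_def)
  then show ?thesis by blast
qed

lemma orthonormal_basis_inner:
  assumes "orthonormal_basis B"
  shows "x \<bullet> y = (\<Sum>u\<in>B. (x \<bullet> u) * (u \<bullet> y))"
proof -
  have "(\<Sum>u\<in>B. (y \<bullet> u) *\<^sub>R u) = y"
    using assms by (intro orthonormal_basis_expand) (auto simp: orthonormal_basis_def)
  then have "x \<bullet> y = x \<bullet> (\<Sum>u\<in>B. (y \<bullet> u) *\<^sub>R u)" by simp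
  also have "\<dots> = (\<Sum>u\<in>B. (x \<bullet> u) * (u \<bullet> y))"
    by (simp add: inner_sum_right inner_commute mult.commute)
  finally show ?thesis .
qed

lemma trace_orthonormal_basis:
  fixes M :: "real^'n^'n"
  assumes "orthonormal_basis B"
  shows "trace M = (\<Sum>u\<in>B. u \<bullet> (M *v u))"
proof -
  have "trace M = (\<Sum>i\<in>UNIV. M $ i \<bullet> axis i 1)"
    by (simp add: trace_def inner_axis)
  also have "\<dots> = (\<Sum>i\<in>UNIV. \<Sum>u\<in>B. (M $ i \<bullet> u) * (u \<bullet> axis i 1))"
    by (rule sum.cong[OF refl orthonormal_basis_inner[OF assms]])
  also have "\<dots> = (\<Sum>u\<in>B. \<Sum>i\<in>UNIV. (M $ i \<bullet> u) * (u \<bullet> axis i 1))"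
    by (rule sum.swap)
  also have "\<dots> = (\<Sum>u\<in>B. u \<bullet> (M *v u))"
    by (rule sum.cong[OF refl])
      (simp add: inner_axis inner_vec_def[of _ "M *v _"] matrix_vector_mul_component mult.commute)
  finally show ?thesis .
qed

text \<open>The trace of a product depends on the matrix entries of the two factors in the basis only, just
  as it does for the standard basis. Traces of products can thus be computed in an eigenbasis
  without changing coordinates by an orthogonal matrix.\<close>
lemma trace_mult_orthonormal_basis:
  fixes M N :: "real^'n^'n"
  assumes "orthonormal_basis B"
  shows "trace (M ** N) = (\<Sum>u\<in>B. \<Sum>v\<in>B. (u \<bullet> (M *v v)) * (v \<bullet> (N *v u)))"
proof -
  have "u \<bullet> (M *v (N *v u)) = (\<Sum>v\<in>B. (u \<bullet> (M *v v)) * (v \<bullet> (N *v u)))" for u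
    using orthonormal_basis_inner[OF assms, of "u v* M" "N *v u"] by (simp add: dot_lmul_matrix)
  then show ?thesis
    by (simp add: trace_orthonormal_basis[OF assms] matrix_vector_mul_assoc[symmetric])
qed

section \<open>The derivative of the matrix exponential\<close>

lemma bounded_bilinear_matrix_mult:
  "bounded_bilinear ((**) :: real^'m^'n \<Rightarrow> real^'p^'m \<Rightarrow> real^'p^'n)"
proof -
  have "bilinear ((**) :: real^'m^'n \<Rightarrow> real^'p^'m \<Rightarrow> real^'p^'n)"
    unfolding bilinear_def
    by (auto intro!: linearI simp: matrix_matrix_mult_def vec_eq_iff sum.distrib sum_distrib_left
        algebra_simps)
  then show ?thesis by (simp add: bilinear_conv_bounded_bilinear)
qed

text \<open>The derivative of \<open>X \<mapsto> X\<^sup>k\<close> in direction \<open>H\<close>, which is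
  \<open>\<Sum>\<^bsub>i + j = k - 1\<^esub> X\<^sup>i H X\<^sup>j\<close>. The recursion is the product rule for \<open>X ** X\<^sup>k\<close>; it makes the
  statements below inductions on \<open>k\<close>.\<close>
primrec matrix_power_deriv :: "real^'n^'n \<Rightarrow> real^'n^'n \<Rightarrow> nat \<Rightarrow> real^'n^'n" where
  "matrix_power_deriv X H 0 = 0"
| "matrix_power_deriv X H (Suc k) = X ** matrix_power_deriv X H k + H ** matrix_power X k"

lemma has_derivative_matrix_power:
  "((\<lambda>X. matrix_power X k) has_derivative (\<lambda>H. matrix_power_deriv X H k)) (at X within S)"
proof (induction k)
  case (Suc k)
  show ?case
    by (simp, rule bounded_bilinear.FDERIV[OF bounded_bilinear_matrix_mult has_derivative_ident Suc.IH])
qed simp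

definition matrix_exp_deriv :: "real^'n^'n \<Rightarrow> real^'n^'n \<Rightarrow> real^'n^'n" where
  "matrix_exp_deriv X H = (\<Sum>k. (1 / fact k) *\<^sub>R matrix_power_deriv X H k)"

lemma summable_times_power_div_fact:
  fixes c :: real
  shows "summable (\<lambda>k. real k * c ^ k / fact k)"
proof -
  have "summable (\<lambda>k. c * (c ^ k / fact k))"
    using summable_exp[of c] by (intro summable_mult) (simp add: field_simps)
  moreover have "real (Suc k) * c ^ Suc k / fact (Suc k) = c * (c ^ k / fact k)" for k
    by (simp add: field_simps del: of_nat_Suc)
  ultimately have "summable (\<lambda>k. real (Suc k) * c ^ Suc k / fact (Suc k))"
    by presburger
  then show ?thesis by (subst (asm) summable_Suc_iff)
qed

text \<open>The norm of \<open>real^'m^'n\<close> is the Frobenius norm, so this is the Cauchy-Schwarz inequality for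
  every entry of the product.\<close>
lemma norm_matrix_mult_le:
  fixes A :: "real^'m^'n" and B :: "real^'p^'m"
  shows "norm (A ** B) \<le> norm A * norm B"
proof -
  have entry: "(A ** B) $ i $ j = A $ i \<bullet> column j B" for i j
    by (simp add: matrix_matrix_mult_def column_def inner_vec_def)
  have cols: "(\<Sum>j\<in>UNIV. column j B \<bullet> column j B) = B \<bullet> B"
    by (simp add: column_def inner_vec_def) (rule sum.swap)
  have "(A ** B) \<bullet> (A ** B) = (\<Sum>i\<in>UNIV. \<Sum>j\<in>UNIV. (A $ i \<bullet> column j B)\<^sup>2)"
    by (simp add: inner_vec_def[of "A ** B"] inner_vec_def[of "(A ** B) $ _"] entry power2_eq_square)
  also have "\<dots> \<le> (\<Sum>i\<in>UNIV. \<Sum>j\<in>UNIV. (A $ i \<bullet> A $ i) * (column j B \<bullet> column j B))"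
    by (intro sum_mono Cauchy_Schwarz_ineq)
  also have "\<dots> = (A \<bullet> A) * (B \<bullet> B)"
    by (simp add: sum_distrib_left[symmetric] sum_distrib_right[symmetric] cols inner_vec_def[of A])
  finally have "(norm (A ** B))\<^sup>2 \<le> (norm A * norm B)\<^sup>2"
    by (simp add: power2_norm_eq_inner power_mult_distrib)
  then show ?thesis by (rule power2_le_imp_le) simp
qed

lemma norm_matrix_power_le:
  fixes X :: "real^'n^'n"
  assumes "norm X \<le> c"
  shows "norm (matrix_power X k) \<le> norm (mat 1 :: real^'n^'n) * c ^ k"
proof (induction k)
  case (Suc k)
  have "0 \<le> c" using assms norm_ge_zero order_trans by blast
  then have "norm (X ** matrix_power X k) \<le> c * (norm (mat 1 :: real^'n^'n) * c ^ k)"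
    using assms by (intro order_trans[OF norm_matrix_mult_le] mult_mono Suc) auto
  then show ?case by (simp add: mult_ac)
qed simp

text \<open>Each of the \<open>k\<close> summands contains \<open>k - 1\<close> factors \<open>X\<close>. The condition \<open>c \<ge> 1\<close> permits the
  exponent \<open>k\<close> in place of \<open>k - 1\<close>, which avoids the truncated subtraction.\<close>
lemma norm_matrix_power_deriv_le:
  fixes X H :: "real^'n^'n"
  assumes X: "norm X \<le> c" and c: "1 \<le> c"
  shows "norm (matrix_power_deriv X H k) \<le> norm (mat 1 :: real^'n^'n) * (real k * c ^ k) * norm H"
proof (induction k)
  case (Suc k)
  let ?C = "norm (mat 1 :: real^'n^'n)"
  have "norm (X ** matrix_power_deriv X H k) \<le> c * (?C * (real k * c ^ k) * norm H)"
    using X c by (intro order_trans[OF norm_matrix_mult_le] mult_mono Suc) auto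
  moreover have "norm (H ** matrix_power X k) \<le> norm H * (?C * c ^ Suc k)"
  proof (intro order_trans[OF norm_matrix_mult_le] mult_left_mono)
    have "c ^ k \<le> c ^ Suc k" using c by (intro power_increasing) auto
    then show "norm (matrix_power X k) \<le> ?C * c ^ Suc k"
      using norm_matrix_power_le[OF X, of k] by (meson mult_left_mono norm_ge_zero order_trans)
  qed simp
  ultimately have "norm (matrix_power_deriv X H (Suc k)) \<le>
      c * (?C * (real k * c ^ k) * norm H) + norm H * (?C * c ^ Suc k)"
    by (simp del: power_Suc) (rule order_trans[OF norm_triangle_ineq], rule add_mono)
  then show ?case by (simp add: algebra_simps)
qed simp

text \<open>The tail bound depends on the dominating series \<open>t\<close> only. This makes the convergence of the
  differentiated exponential series uniform on balls.\<close>
lemma norm_suminf_tail_le: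
  fixes f :: "nat \<Rightarrow> 'a::banach"
  assumes t: "summable t" and bound: "\<And>k. norm (f k) \<le> t k"
  shows "norm (sum f {..<n} - suminf f) \<le> (\<Sum>k. t (k + n))"
proof -
  have norm_f: "summable (\<lambda>k. norm (f k))"
    by (rule summable_comparison_test'[OF t]) (simp add: bound)
  have "suminf f - sum f {..<n} = (\<Sum>k. f (k + n))"
    by (rule suminf_minus_initial_segment[OF summable_norm_cancel[OF norm_f], symmetric])
  then have "norm (sum f {..<n} - suminf f) = norm (\<Sum>k. f (k + n))"
    by (metis norm_minus_commute)
  also have "\<dots> \<le> (\<Sum>k. norm (f (k + n)))"
    by (rule summable_norm[OF summable_ignore_initial_segment[OF norm_f]])
  also have "\<dots> \<le> (\<Sum>k. t (k + n))"
    by (rule suminf_le[OF bound summable_ignore_initial_segment[OF norm_f]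
          summable_ignore_initial_segment[OF t]])
  finally show ?thesis .
qed

lemma matrix_exponential_sums:
  "(\<lambda>k. (1 / fact k) *\<^sub>R matrix_power X k) sums matrix_exponential (X :: real^'n^'n)"
proof -
  let ?C = "norm (mat 1 :: real^'n^'n)"
  have "summable (\<lambda>k. ?C * (norm X ^ k / fact k))"
    using summable_exp[of "norm X"] by (intro summable_mult) (simp add: field_simps)
  moreover have "norm ((1 / fact k) *\<^sub>R matrix_power X k) \<le> ?C * (norm X ^ k / fact k)" for k
    using norm_matrix_power_le[OF order_refl, of X k] by (simp add: divide_right_mono)
  ultimately have "summable (\<lambda>k. (1 / fact k) *\<^sub>R matrix_power X k)"
    by (rule summable_comparison_test')
  then show ?thesis unfolding matrix_exponential_def by (rule summable_sums)
qed

lemma norm_matrix_exp_deriv_term_le: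
  fixes X H :: "real^'n^'n"
  assumes "norm X \<le> c" "1 \<le> c"
  shows "norm ((1 / fact k) *\<^sub>R matrix_power_deriv X H k) \<le>
    norm (mat 1 :: real^'n^'n) * (real k * c ^ k / fact k) * norm H"
  using divide_right_mono[OF norm_matrix_power_deriv_le[OF assms, of H k], of "fact k"] by simp

lemma matrix_exp_deriv_sums:
  "(\<lambda>k. (1 / fact k) *\<^sub>R matrix_power_deriv X H k) sums matrix_exp_deriv X (H :: real^'n^'n)"
proof -
  have "summable (\<lambda>k. norm (mat 1 :: real^'n^'n) * (real k * (norm X + 1) ^ k / fact k) * norm H)"
    by (intro summable_mult summable_mult2 summable_times_power_div_fact)
  then have "summable (\<lambda>k. (1 / fact k) *\<^sub>R matrix_power_deriv X H k)"
    by (rule summable_comparison_test') (rule norm_matrix_exp_deriv_term_le; simp)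
  then show ?thesis unfolding matrix_exp_deriv_def by (rule summable_sums)
qed

text \<open>Termwise differentiation of the exponential series. Since \<open>X\<close> and the direction \<open>H\<close> need
  not commute, the derivative differs from \<open>matrix_exponential X ** H\<close> in general, although for
  symmetric \<open>X\<close> the two have the same trace.\<close>
theorem has_derivative_matrix_exponential:
  fixes X :: "real^'n^'n"
  shows "(matrix_exponential has_derivative matrix_exp_deriv X) (at X)"
proof -
  define R where "R = norm X + 1"
  let ?S = "ball 0 R :: (real^'n^'n) set"
  define t where "t k = norm (mat 1 :: real^'n^'n) * (real k * R ^ k / fact k)" for k
  have t: "summable t"
    unfolding t_def by (intro summable_mult summable_times_power_div_fact)
  have tail: "norm ((\<Sum>k<n. (1 / fact k) *\<^sub>R matrix_power_deriv x h k) - matrix_exp_deriv x h)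
      \<le> (\<Sum>k. t (k + n)) * norm h" if "x \<in> ?S" for x h n
  proof -
    have "norm ((\<Sum>k<n. (1 / fact k) *\<^sub>R matrix_power_deriv x h k) - matrix_exp_deriv x h)
        \<le> (\<Sum>k. t (k + n) * norm h)"
      unfolding matrix_exp_deriv_def
      by (rule norm_suminf_tail_le[OF summable_mult2[OF t]])
        (unfold t_def, rule norm_matrix_exp_deriv_term_le, use that in \<open>auto simp: R_def\<close>)
    also have "\<dots> = (\<Sum>k. t (k + n)) * norm h"
      by (rule suminf_mult2[symmetric]) (simp add: t)
    finally show ?thesis .
  qed
  have "\<exists>g. \<forall>x\<in>?S. (\<lambda>k. (1 / fact k) *\<^sub>R matrix_power x k) sums (g x) \<and>
      (g has_derivative matrix_exp_deriv x) (at x within ?S)"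
  proof (rule has_derivative_series[OF convex_ball])
    show "((\<lambda>x. (1 / fact k) *\<^sub>R matrix_power x k) has_derivative
        (\<lambda>h. (1 / fact k) *\<^sub>R matrix_power_deriv x h k)) (at x within ?S)" for k x
      by (intro has_derivative_scaleR_right has_derivative_matrix_power)
    show "\<forall>\<^sub>F n in sequentially. \<forall>x\<in>?S. \<forall>h.
        norm ((\<Sum>k<n. (1 / fact k) *\<^sub>R matrix_power_deriv x h k) - matrix_exp_deriv x h) \<le> e * norm h"
      if "e > 0" for e
    proof -
      have "(\<lambda>n. \<Sum>k. t (k + n)) \<longlonglongrightarrow> 0" using t by (rule suminf_exist_split2)
      then have "\<forall>\<^sub>F n in sequentially. (\<Sum>k. t (k + n)) < e"
        using that by (rule order_tendstoD(2))
      then show ?thesis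
        by eventually_elim (use tail in \<open>meson less_imp_le mult_right_mono norm_ge_zero order_trans\<close>)
    qed
    show "(\<lambda>k. (1 / fact k) *\<^sub>R matrix_power X k) sums matrix_exponential X"
      by (rule matrix_exponential_sums)
  qed (simp add: R_def)
  then obtain g where g: "\<And>x. x \<in> ?S \<Longrightarrow> (\<lambda>k. (1 / fact k) *\<^sub>R matrix_power x k) sums g x"
    "\<And>x. x \<in> ?S \<Longrightarrow> (g has_derivative matrix_exp_deriv x) (at x within ?S)" by blast
  have XS: "X \<in> ?S" by (simp add: R_def)
  have "(g has_derivative matrix_exp_deriv X) (at X)"
    using g(2)[OF XS] at_within_open[OF XS] by simp
  then show ?thesis
    by (rule has_derivative_transform_within_open[OF _ open_ball XS])
      (use g(1) matrix_exponential_sums sums_unique2 in blast)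
qed

section \<open>Divided differences of the exponential\<close>

text \<open>The scalar counterpart of \<open>matrix_power_deriv\<close>: the divided difference of \<open>x \<mapsto> x\<^sup>k\<close> at \<open>a\<close>
  and \<open>b\<close>, in the form \<open>\<Sum>\<^bsub>i + j = k - 1\<^esub> a\<^sup>i b\<^sup>j\<close> that needs no case distinction for \<open>a = b\<close>.\<close>
primrec power_divdiff :: "real \<Rightarrow> real \<Rightarrow> nat \<Rightarrow> real" where
  "power_divdiff a b 0 = 0"
| "power_divdiff a b (Suc k) = a * power_divdiff a b k + b ^ k"

definition exp_divdiff :: "real \<Rightarrow> real \<Rightarrow> real" where
  "exp_divdiff a b = (if a = b then exp a else (exp a - exp b) / (a - b))"

lemma power_divdiff_eq: "(a - b) * power_divdiff a b k = a ^ k - b ^ k"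
proof (induction k)
  case (Suc k)
  have "(a - b) * power_divdiff a b (Suc k) = a * ((a - b) * power_divdiff a b k) + (a - b) * b ^ k"
    by (simp add: algebra_simps)
  also have "\<dots> = a ^ Suc k - b ^ Suc k"
    unfolding Suc by (simp add: algebra_simps)
  finally show ?case .
qed simp

lemma power_divdiff_diag: "power_divdiff a a (Suc k) = real (Suc k) * a ^ k"
  by (induction k) (auto simp: algebra_simps)

lemma exp_divdiff_sums: "(\<lambda>k. power_divdiff a b k / fact k) sums exp_divdiff a b"
proof (cases "a = b")
  case True
  have "(\<lambda>k. a ^ k / fact k) sums exp a"
    using exp_converges[of a] by (simp add: field_simps)
  moreover have "power_divdiff a a (Suc k) / fact (Suc k) = a ^ k / fact k" for k
    unfolding power_divdiff_diag fact_Suc by (simp del: of_nat_Suc)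
  ultimately have "(\<lambda>k. power_divdiff a a (Suc k) / fact (Suc k)) sums exp a"
    by presburger
  then have "(\<lambda>k. power_divdiff a a k / fact k) sums exp a"
    by (subst (asm) sums_Suc_iff) simp
  then show ?thesis using True by (simp add: exp_divdiff_def)
next
  case False
  have "(\<lambda>k. a ^ k / fact k - b ^ k / fact k) sums (exp a - exp b)"
    using sums_diff[OF exp_converges[of a] exp_converges[of b]] by (simp add: field_simps)
  then have "(\<lambda>k. (a ^ k / fact k - b ^ k / fact k) / (a - b)) sums ((exp a - exp b) / (a - b))"
    by (rule sums_divide)
  moreover have "(a ^ k / fact k - b ^ k / fact k) / (a - b) = power_divdiff a b k / fact k" for k
  proof -
    have "power_divdiff a b k = (a ^ k - b ^ k) / (a - b)"
      using power_divdiff_eq[of a b k] False by (simp add: eq_divide_eq mult.commute)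
    then show ?thesis by (simp add: diff_divide_distrib mult.commute)
  qed
  ultimately show ?thesis using False by (simp add: exp_divdiff_def)
qed

lemma exp_divdiff_sym: "exp_divdiff a b = exp_divdiff b a"
  by (simp add: exp_divdiff_def) (metis minus_diff_eq minus_divide_divide)

text \<open>The trapezoidal rule overestimates the integral of the convex function \<open>exp\<close> over \<open>[0, t]\<close>.
  The difference of the two sides vanishes at \<open>0\<close> and has derivative \<open>(1 + (s - 1) * exp s) / 2\<close>,
  which is nonnegative because \<open>1 - s \<le> exp (- s)\<close>.\<close>
lemma exp_minus_one_le_trapezoid:
  fixes t :: real
  assumes "0 \<le> t"
  shows "exp t - 1 \<le> t * (exp t + 1) / 2"
proof -
  let ?g = "\<lambda>t::real. t * (exp t + 1) / 2 - (exp t - 1)"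
  have "?g 0 \<le> ?g t"
  proof (rule DERIV_nonneg_imp_nondecreasing[OF assms])
    fix s :: real
    have "(?g has_real_derivative (1 + (s - 1) * exp s) / 2) (at s)"
      by (auto intro!: derivative_eq_intros simp: field_simps)
    moreover have "(1 - s) * exp s \<le> exp (- s) * exp s"
      using exp_ge_add_one_self[of "- s"] by (intro mult_right_mono) auto
    then have "0 \<le> (1 + (s - 1) * exp s) / 2"
      by (simp add: exp_minus algebra_simps)
    ultimately show "\<exists>y. (?g has_real_derivative y) (at s) \<and> 0 \<le> y" by blast
  qed
  then show ?thesis by simp
qed

text \<open>The divided difference is the mean value of \<open>exp\<close> between \<open>a\<close> and \<open>b\<close>, so the trapezoidal
  rule bounds it by the mean of the endpoint values. The bound separates \<open>a\<close> from \<open>b\<close>, so that after division by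
  the trace of the exponential it involves one probability weight for each of the two eigenvalues.\<close>
lemma exp_divdiff_le_mean: "exp_divdiff a b \<le> (exp a + exp b) / 2"
proof -
  have *: "exp_divdiff a b \<le> (exp a + exp b) / 2" if "b < a" for a b
  proof -
    have "exp b * (exp (a - b) - 1) \<le> exp b * ((a - b) * (exp (a - b) + 1) / 2)"
      using that by (intro mult_left_mono exp_minus_one_le_trapezoid) auto
    moreover have "exp b * exp (a - b) = exp a" by (simp flip: exp_add)
    ultimately have "exp a - exp b \<le> (a - b) * ((exp a + exp b) / 2)"
      by (simp add: algebra_simps)
    then show ?thesis using that by (simp add: exp_divdiff_def divide_le_eq mult.commute)
  qed
  show ?thesis
    using *[of b a] *[of a b] exp_divdiff_sym[of a b] exp_divdiff_def[of a a]
    by (cases a b rule: linorder_cases) (auto simp: add.commute)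
qed

section \<open>The matrix exponential in an eigenbasis\<close>

lemma matrix_power_eigenvector:
  assumes "X *v v = a *\<^sub>R v"
  shows "matrix_power X k *v v = a ^ k *\<^sub>R v"
proof (induction k)
  case (Suc k)
  then show ?case
    by (simp add: matrix_vector_mul_assoc[symmetric] matrix_vector_mult_scaleR assms mult.commute)
qed simp

lemma inner_matrix_power_deriv_eigenvectors:
  assumes sym: "symmetric_matrix X" and u: "X *v u = a *\<^sub>R u" and v: "X *v v = b *\<^sub>R v"
  shows "u \<bullet> (matrix_power_deriv X H k *v v) = power_divdiff a b k * (u \<bullet> (H *v v))"
proof (induction k)
  case (Suc k)
  have "u \<bullet> (X *v w) = a * (u \<bullet> w)" for w
    using symmetric_matrix_inner[OF sym, of u w] by (simp add: u)
  then show ?case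
    by (simp add: matrix_vector_mult_add_rdistrib matrix_vector_mul_assoc[symmetric] inner_add_right
        matrix_power_eigenvector[OF v] matrix_vector_mult_scaleR Suc algebra_simps)
qed simp

lemma bounded_linear_matrix_coefficient:
  "bounded_linear (\<lambda>M :: real^'n^'n. u \<bullet> (M *v v))"
proof -
  have "linear (\<lambda>M :: real^'n^'n. u \<bullet> (M *v v))"
    by (intro linearI) (simp_all add: matrix_vector_mult_add_rdistrib inner_add_right
        scaleR_matrix_vector_assoc[symmetric])
  then show ?thesis by (simp add: linear_conv_bounded_linear)
qed

lemma matrix_exponential_eigenvector:
  assumes v: "X *v v = b *\<^sub>R v"
  shows "matrix_exponential X *v v = exp b *\<^sub>R v"
proof -
  have "u \<bullet> (matrix_exponential X *v v) = u \<bullet> (exp b *\<^sub>R v)" for u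
  proof -
    have "(\<lambda>k. u \<bullet> (((1 / fact k) *\<^sub>R matrix_power X k) *v v)) sums
        (u \<bullet> (matrix_exponential X *v v))"
      by (rule bounded_linear.sums[OF bounded_linear_matrix_coefficient matrix_exponential_sums])
    moreover have "u \<bullet> (((1 / fact k) *\<^sub>R matrix_power X k) *v v) = (b ^ k /\<^sub>R fact k) * (u \<bullet> v)"
      for k
      by (simp add: scaleR_matrix_vector_assoc[symmetric] matrix_power_eigenvector[OF v] field_simps)
    ultimately show ?thesis
      using sums_mult2[OF exp_converges[of b], of "u \<bullet> v"] sums_unique2 by auto
  qed
  then show ?thesis using vector_eq_rdot[of "matrix_exponential X *v v"] by (metis inner_commute)
qed

text \<open>The Daleckii-Krein formula for the exponential: in an eigenbasis of \<open>X\<close> the derivative multiplies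
  each entry of \<open>H\<close> by a divided difference of \<open>exp\<close>.\<close>
lemma inner_matrix_exp_deriv_eigenvectors:
  assumes "symmetric_matrix X" "X *v u = a *\<^sub>R u" "X *v v = b *\<^sub>R v"
  shows "u \<bullet> (matrix_exp_deriv X H *v v) = exp_divdiff a b * (u \<bullet> (H *v v))"
proof -
  have "(\<lambda>k. u \<bullet> (((1 / fact k) *\<^sub>R matrix_power_deriv X H k) *v v)) sums
      (u \<bullet> (matrix_exp_deriv X H *v v))"
    by (rule bounded_linear.sums[OF bounded_linear_matrix_coefficient matrix_exp_deriv_sums])
  moreover have "u \<bullet> (((1 / fact k) *\<^sub>R matrix_power_deriv X H k) *v v) =
      power_divdiff a b k / fact k * (u \<bullet> (H *v v))" for k
    by (simp add: scaleR_matrix_vector_assoc[symmetric] inner_matrix_power_deriv_eigenvectors[OF assms])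
  ultimately show ?thesis
    using sums_mult2[OF exp_divdiff_sums, of a b "u \<bullet> (H *v v)"] sums_unique2 by auto
qed

section \<open>A variance bound\<close>

text \<open>The variance equals \<open>\<Sum>\<^bsub>u, v\<^esub> p\<^sub>u p\<^sub>v (x\<^sub>u - x\<^sub>v)\<^sup>2 / 2\<close>. Bounding the terms with \<open>u \<noteq> v\<close>
  by \<open>(x\<^sub>u - x\<^sub>v)\<^sup>2 \<le> 2 x\<^sub>u\<^sup>2 + 2 x\<^sub>v\<^sup>2\<close> leaves \<open>2 \<Sum>\<^bsub>u\<^esub> p\<^sub>u (1 - p\<^sub>u) x\<^sub>u\<^sup>2\<close>, and
  \<open>p\<^sub>u (1 - p\<^sub>u) \<le> 1/4\<close>. Equality holds for two points with \<open>p = 1/2\<close> and \<open>x = \<plusminus>1\<close>.\<close>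
lemma variance_le_half_sum_squares:
  fixes p x :: "'a \<Rightarrow> real"
  assumes fin: "finite B" and p: "\<And>u. u \<in> B \<Longrightarrow> 0 \<le> p u" and p1: "sum p B = 1"
  shows "(\<Sum>u\<in>B. p u * (x u)\<^sup>2) - (\<Sum>u\<in>B. p u * x u)\<^sup>2 \<le> (\<Sum>u\<in>B. (x u)\<^sup>2) / 2"
proof -
  let ?M = "\<Sum>u\<in>B. p u * (x u)\<^sup>2" and ?S = "\<Sum>u\<in>B. p u * x u"
  have 1: "(\<Sum>u\<in>B. \<Sum>v\<in>B. p u * (x u)\<^sup>2 * p v) = ?M"
    by (simp add: p1 flip: sum_distrib_left)
  have 2: "(\<Sum>u\<in>B. \<Sum>v\<in>B. p u * (p v * (x v)\<^sup>2)) = ?M"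
    by (simp add: p1 flip: sum_distrib_left sum_distrib_right)
  have 3: "(\<Sum>u\<in>B. \<Sum>v\<in>B. p u * x u * (p v * x v)) = ?S\<^sup>2"
    by (simp add: power2_eq_square flip: sum_distrib_left sum_distrib_right)
  have pull: "(\<Sum>u\<in>B. \<Sum>v\<in>B. c * F u v) = c * (\<Sum>u\<in>B. \<Sum>v\<in>B. F u v)"
    for c :: real and F :: "'a \<Rightarrow> 'a \<Rightarrow> real"
    by (simp add: sum_distrib_left)
  have "2 * (?M - ?S\<^sup>2) = (\<Sum>u\<in>B. \<Sum>v\<in>B. p u * p v * (x u - x v)\<^sup>2)"
  proof -
    have "(\<Sum>u\<in>B. \<Sum>v\<in>B. p u * p v * (x u - x v)\<^sup>2) =
        (\<Sum>u\<in>B. \<Sum>v\<in>B. p u * (x u)\<^sup>2 * p v + p u * (p v * (x v)\<^sup>2) - 2 * (p u * x u * (p v * x v)))"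
      by (intro sum.cong refl) (simp add: power2_eq_square algebra_simps)
    also have "\<dots> = ?M + ?M - 2 * ?S\<^sup>2"
      by (simp only: sum_subtractf sum.distrib pull 1 2 3)
    finally show ?thesis by simp
  qed
  \<comment> \<open>The correction for \<open>u = v\<close> restores the diagonal terms to their true value \<open>0\<close>.\<close>
  also have "\<dots> \<le> (\<Sum>u\<in>B. \<Sum>v\<in>B. 2 * (p u * (x u)\<^sup>2 * p v) + 2 * (p u * (p v * (x v)\<^sup>2))
      - (if u = v then 4 * ((p u)\<^sup>2 * (x u)\<^sup>2) else 0))"
  proof (intro sum_mono)
    fix u v assume uv: "u \<in> B" "v \<in> B"
    have "p u * p v * (x u - x v)\<^sup>2 \<le> p u * p v * (2 * (x u)\<^sup>2 + 2 * (x v)\<^sup>2)"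
    proof (rule mult_left_mono)
      have "0 \<le> (x u + x v)\<^sup>2" by simp
      then show "(x u - x v)\<^sup>2 \<le> 2 * (x u)\<^sup>2 + 2 * (x v)\<^sup>2"
        by (simp add: power2_eq_square algebra_simps)
    qed (use p uv in simp)
    then show "p u * p v * (x u - x v)\<^sup>2 \<le> 2 * (p u * (x u)\<^sup>2 * p v) + 2 * (p u * (p v * (x v)\<^sup>2))
        - (if u = v then 4 * ((p u)\<^sup>2 * (x u)\<^sup>2) else 0)"
      by (cases "u = v") (simp_all add: power2_eq_square algebra_simps)
  qed
  also have "\<dots> = 2 * ?M + 2 * ?M - (\<Sum>u\<in>B. 4 * ((p u)\<^sup>2 * (x u)\<^sup>2))"
    using fin by (simp only: sum_subtractf sum.distrib pull 1 2) simp
  also have "\<dots> = (\<Sum>u\<in>B. 4 * (p u * (1 - p u)) * (x u)\<^sup>2)"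
    by (simp add: sum_distrib_left sum_subtractf algebra_simps power2_eq_square)
  also have "\<dots> \<le> (\<Sum>u\<in>B. 1 * (x u)\<^sup>2)"
  proof (intro sum_mono mult_right_mono)
    fix u
    have "0 \<le> (2 * p u - 1)\<^sup>2" by simp
    then show "4 * (p u * (1 - p u)) \<le> 1" by (simp add: power2_eq_square algebra_simps)
  qed simp
  finally show ?thesis by simp
qed

text \<open>The diagonal and the off-diagonal entries of \<open>h\<close> separate. Off the diagonal, the weight is at
  most \<open>(p u + p v) / 2 \<le> 1/2\<close>, since two distinct points have total mass at most \<open>1\<close>. The diagonal
  entries together with the subtracted square form a variance.\<close>
lemma quadratic_form_minus_square_le:
  fixes p :: "'a \<Rightarrow> real" and g h :: "'a \<Rightarrow> 'a \<Rightarrow> real"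
  assumes fin: "finite B" and p: "\<And>u. u \<in> B \<Longrightarrow> 0 \<le> p u" and p1: "sum p B = 1"
    and g: "\<And>u v. u \<in> B \<Longrightarrow> v \<in> B \<Longrightarrow> g u v \<le> (p u + p v) / 2"
  shows "(\<Sum>u\<in>B. \<Sum>v\<in>B. g u v * (h u v)\<^sup>2) - (\<Sum>u\<in>B. p u * h u u)\<^sup>2
    \<le> (\<Sum>u\<in>B. \<Sum>v\<in>B. (h u v)\<^sup>2) / 2"
proof -
  have "(\<Sum>u\<in>B. \<Sum>v\<in>B. g u v * (h u v)\<^sup>2) \<le>
      (\<Sum>u\<in>B. \<Sum>v\<in>B. (h u v)\<^sup>2 / 2 + (if u = v then p u * (h u u)\<^sup>2 - (h u u)\<^sup>2 / 2 else 0))"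
  proof (intro sum_mono)
    fix u v assume uv: "u \<in> B" "v \<in> B"
    show "g u v * (h u v)\<^sup>2 \<le> (h u v)\<^sup>2 / 2 + (if u = v then p u * (h u u)\<^sup>2 - (h u u)\<^sup>2 / 2 else 0)"
    proof (cases "u = v")
      case True
      then show ?thesis using mult_right_mono[OF g[OF uv], of "(h u v)\<^sup>2"] by simp
    next
      case False
      have "p u + p v = sum p {u, v}" using False by simp
      also have "\<dots> \<le> sum p B" using uv fin p by (intro sum_mono2) auto
      finally have "g u v \<le> 1 / 2" using g[OF uv] p1 by simp
      then show ?thesis using False mult_right_mono[of "g u v" "1 / 2" "(h u v)\<^sup>2"] by simp
    qed
  qed
  also have "\<dots> = (\<Sum>u\<in>B. \<Sum>v\<in>B. (h u v)\<^sup>2) / 2 +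
      ((\<Sum>u\<in>B. p u * (h u u)\<^sup>2) - (\<Sum>u\<in>B. (h u u)\<^sup>2) / 2)"
    using fin by (simp add: sum.distrib sum_subtractf sum_divide_distrib)
  finally show ?thesis
    using variance_le_half_sum_squares[OF fin p p1, of "\<lambda>u. h u u"] by simp
qed

section \<open>Traces of the matrix exponential and of its derivative\<close>

lemma bounded_linear_trace_mult:
  "bounded_linear (\<lambda>N :: real^'n^'n. trace (M ** N))"
proof -
  have "linear (\<lambda>N. trace (M ** N))"
    by (intro linearI)
      (simp_all add: matrix_add_ldistrib trace_add matrix_scalar_ac scalar_matrix_assoc[symmetric]
        trace_def[of "_ *\<^sub>R _"] trace_def[of "M ** _"] sum_distrib_left)
  then show ?thesis by (simp add: linear_conv_bounded_linear)
qed

lemma bounded_linear_trace: "bounded_linear (trace :: real^'n^'n \<Rightarrow> real)"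
  using bounded_linear_trace_mult[of "mat 1"] by simp

context
  fixes X :: "real^'n^'n" and B
  assumes sym: "symmetric_matrix X" and B: "eigenbasis X B"
begin

lemma eigenbasis_orthonormal: "orthonormal_basis B"
  using B by (simp add: eigenbasis_def)

lemma trace_matrix_exponential: "trace (matrix_exponential X) = (\<Sum>u\<in>B. exp (u \<bullet> (X *v u)))"
  unfolding trace_orthonormal_basis[OF eigenbasis_orthonormal]
proof (rule sum.cong[OF refl])
  fix u assume "u \<in> B"
  then have "X *v u = (u \<bullet> (X *v u)) *\<^sub>R u" "u \<bullet> u = 1"
    using B by (auto simp: eigenbasis_def orthonormal_basis_def norm_eq_1)
  then show "u \<bullet> (matrix_exponential X *v u) = exp (u \<bullet> (X *v u))"
    using matrix_exponential_eigenvector[of X u "u \<bullet> (X *v u)"] by simp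
qed

lemma trace_matrix_exponential_mult:
  "trace (matrix_exponential X ** H) = (\<Sum>u\<in>B. exp (u \<bullet> (X *v u)) * (u \<bullet> (H *v u)))"
  unfolding trace_mul_sym[of _ H] unfolding trace_orthonormal_basis[OF eigenbasis_orthonormal]
proof (rule sum.cong[OF refl])
  fix u assume "u \<in> B"
  then have "X *v u = (u \<bullet> (X *v u)) *\<^sub>R u" using B by (auto simp: eigenbasis_def)
  from matrix_exponential_eigenvector[OF this]
  show "u \<bullet> ((H ** matrix_exponential X) *v u) = exp (u \<bullet> (X *v u)) * (u \<bullet> (H *v u))"
    by (simp add: matrix_vector_mul_assoc[symmetric] matrix_vector_mult_scaleR)
qed

lemma inner_matrix_exp_deriv_eigenbasis:
  assumes "u \<in> B" "v \<in> B"
  shows "u \<bullet> (matrix_exp_deriv X H *v v) = exp_divdiff (u \<bullet> (X *v u)) (v \<bullet> (X *v v)) * (u \<bullet> (H *v v))"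
  using B assms by (intro inner_matrix_exp_deriv_eigenvectors sym) (auto simp: eigenbasis_def)

text \<open>Only divided differences at coinciding points enter the trace, and these are values of \<open>exp\<close>.\<close>
lemma trace_matrix_exp_deriv:
  "trace (matrix_exp_deriv X H) = trace (matrix_exponential X ** H)"
  unfolding trace_matrix_exponential_mult
  unfolding trace_orthonormal_basis[OF eigenbasis_orthonormal]
  by (simp add: inner_matrix_exp_deriv_eigenbasis exp_divdiff_def)

lemma trace_matrix_exp_deriv_mult:
  "trace (matrix_exp_deriv X H ** G) =
    (\<Sum>u\<in>B. \<Sum>v\<in>B. exp_divdiff (u \<bullet> (X *v u)) (v \<bullet> (X *v v)) * (u \<bullet> (H *v v)) * (v \<bullet> (G *v u)))"
  by (simp add: trace_mult_orthonormal_basis[OF eigenbasis_orthonormal] inner_matrix_exp_deriv_eigenbasis)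

end

lemma trace_matrix_exponential_pos:
  fixes X :: "real^'n^'n"
  assumes "symmetric_matrix X"
  shows "0 < trace (matrix_exponential X)"
proof -
  obtain B where B: "eigenbasis X B" using symmetric_matrix_has_eigenbasis[OF assms] by blast
  have "axis undefined 1 \<noteq> (0 :: real^'n)" by (simp add: axis_eq_0_iff)
  then have "B \<noteq> {}" and "finite B"
    using B by (auto simp: eigenbasis_def orthonormal_basis_def)
  then show ?thesis unfolding trace_matrix_exponential[OF assms B] by (intro sum_pos) auto
qed

text \<open>The symmetry of the second derivative. The entry formula shows it directly, since divided
  differences are symmetric in their two arguments.\<close>
lemma trace_matrix_exp_deriv_commute:
  assumes "symmetric_matrix X"
  shows "trace (matrix_exp_deriv X H ** G) = trace (matrix_exp_deriv X G ** H)"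
proof -
  obtain B where B: "eigenbasis X B" using symmetric_matrix_has_eigenbasis[OF assms] by blast
  show ?thesis
    unfolding trace_matrix_exp_deriv_mult[OF assms B]
    by (subst sum.swap) (simp add: exp_divdiff_sym mult_ac)
qed

text \<open>The left-hand side is the second derivative of \<open>ln (trace (matrix_exponential X))\<close> in direction
  \<open>H\<close>. In an eigenbasis of \<open>X\<close> it has the form treated in \<open>quadratic_form_minus_square_le\<close>, where
  the weights \<open>p\<close> are the eigenvalues of the density matrix, the exponential scaled to trace \<open>1\<close>.\<close>
theorem log_trace_exp_second_derivative_le:
  fixes X H :: "real^'n^'n"
  assumes X: "symmetric_matrix X" and H: "symmetric_matrix H"
  shows "trace (matrix_exp_deriv X H ** H) / trace (matrix_exponential X)
      - (trace (matrix_exponential X ** H) / trace (matrix_exponential X))\<^sup>2 \<le> trace (H ** H) / 2"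
proof -
  obtain B where B: "eigenbasis X B" using symmetric_matrix_has_eigenbasis[OF X] by blast
  then have ob: "orthonormal_basis B" and fin: "finite B"
    by (auto simp: eigenbasis_def orthonormal_basis_def)
  define Z where "Z = trace (matrix_exponential X)"
  define l where "l u = u \<bullet> (X *v u)" for u
  define h where "h u v = u \<bullet> (H *v v)" for u v
  define p where "p u = exp (l u) / Z" for u
  define g where "g u v = exp_divdiff (l u) (l v) / Z" for u v
  have Z: "Z > 0" using trace_matrix_exponential_pos[OF X] by (simp add: Z_def)
  have hsym: "h v u = h u v" for u v
    using symmetric_matrix_inner[OF H, of v u] by (simp add: h_def inner_commute)
  have "(\<Sum>u\<in>B. \<Sum>v\<in>B. g u v * (h u v)\<^sup>2) - (\<Sum>u\<in>B. p u * h u u)\<^sup>2 \<le>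
      (\<Sum>u\<in>B. \<Sum>v\<in>B. (h u v)\<^sup>2) / 2"
  proof (rule quadratic_form_minus_square_le[OF fin])
    show "0 \<le> p u" for u using Z by (simp add: p_def)
    show "sum p B = 1"
      using Z trace_matrix_exponential[OF X B]
      by (simp add: p_def l_def Z_def flip: sum_divide_distrib)
    show "g u v \<le> (p u + p v) / 2" for u v
      using divide_right_mono[OF exp_divdiff_le_mean, of Z "l u" "l v"] Z
      by (simp add: g_def p_def add_divide_distrib)
  qed
  moreover have "(\<Sum>u\<in>B. \<Sum>v\<in>B. g u v * (h u v)\<^sup>2) = trace (matrix_exp_deriv X H ** H) / Z"
    by (simp add: trace_matrix_exp_deriv_mult[OF X B] g_def sum_divide_distrib hsym power2_eq_square
        mult.assoc flip: h_def l_def)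
  moreover have "(\<Sum>u\<in>B. p u * h u u) = trace (matrix_exponential X ** H) / Z"
    by (simp add: trace_matrix_exponential_mult[OF X B] p_def sum_divide_distrib flip: h_def l_def)
  moreover have "(\<Sum>u\<in>B. \<Sum>v\<in>B. (h u v)\<^sup>2) = trace (H ** H)"
    by (simp add: trace_mult_orthonormal_basis[OF ob] hsym power2_eq_square flip: h_def)
  ultimately show ?thesis by (simp add: Z_def)
qed

section \<open>The Hessian of the log-partition function\<close>

lemma bounded_linear_lin_comb: "bounded_linear (lin_comb A)"
proof -
  have "linear (lin_comb A)"
    by (intro linearI) (simp_all add: lin_comb_def scaleR_add_left sum.distrib scaleR_sum_right)
  then show ?thesis by (simp add: linear_conv_bounded_linear)
qed

lemma lin_comb_axis: "lin_comb A (axis i 1) = A i"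
proof -
  have "lin_comb A (axis i 1) = (\<Sum>j\<in>UNIV. if j = i then A j else 0)"
    unfolding lin_comb_def by (intro sum.cong refl) (auto simp: axis_def)
  then show ?thesis by simp
qed

lemma symmetric_matrix_lin_comb:
  assumes "\<And>i. symmetric_matrix (A i)"
  shows "symmetric_matrix (lin_comb A y)"
  using assms by (simp add: symmetric_matrix_def lin_comb_def transpose_def vec_eq_iff)

lemma trace_mult_lin_comb: "trace (M ** lin_comb A y) = (\<Sum>i\<in>UNIV. y $ i * trace (M ** A i))"
proof -
  interpret bounded_linear "\<lambda>N. trace (M ** N)" by (rule bounded_linear_trace_mult)
  show ?thesis by (simp add: lin_comb_def sum scaleR)
qed

text \<open>For symmetric matrices \<open>trace (X ** Y)\<close> is the Frobenius inner product, so the lemma turns a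
  bound by the Frobenius norm of the direction into a bound by the Euclidean norm of its
  coefficients.\<close>
lemma trace_lin_comb_square:
  assumes orth: "\<And>i j. trace (A i ** A j) = (if i = j then 1 else 0)"
  shows "trace (lin_comb A y ** lin_comb A y) = y \<bullet> y"
proof -
  have "trace (lin_comb A y ** A i) = y $ i" for i
    by (simp add: trace_mul_sym[of _ "A i"] trace_mult_lin_comb orth mult_delta_right)
  then show ?thesis by (simp add: trace_mult_lin_comb inner_vec_def)
qed

lemma has_derivative_vec_componentwise:
  fixes f :: "'a::real_normed_vector \<Rightarrow> real^'m"
  assumes "\<And>i. ((\<lambda>x. f x $ i) has_derivative (\<lambda>h. f' h $ i)) (at x)"
  shows "(f has_derivative f') (at x)"
  using assms unfolding has_derivative_componentwise_within[of f]
  by (auto simp: Basis_vec_def inner_axis)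

text \<open>Symmetry of the \<open>A i\<close> makes the partition function \<open>trace (E y)\<close> positive, so that its logarithm
  is differentiable.\<close>
locale log_partition =
  fixes A :: "'m::finite \<Rightarrow> real^'n^'n" and b :: "real^'m" and f :: "real^'m \<Rightarrow> real"
  assumes sym: "\<And>i. symmetric_matrix (A i)"
    and f: "\<And>y. f y = ln (trace (matrix_exponential (lin_comb A y))) - b \<bullet> y"
begin

abbreviation E :: "real^'m \<Rightarrow> real^'n^'n" where
  "E y \<equiv> matrix_exponential (lin_comb A y)"

abbreviation L :: "real^'m \<Rightarrow> real^'m \<Rightarrow> real^'n^'n" where
  "L y h \<equiv> matrix_exp_deriv (lin_comb A y) (lin_comb A h)"

lemma symmetric_lin_comb: "symmetric_matrix (lin_comb A y)"
  by (rule symmetric_matrix_lin_comb[OF sym])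

lemma partition_pos: "0 < trace (E y)"
  by (rule trace_matrix_exponential_pos[OF symmetric_lin_comb])

lemma has_derivative_exp_lin_comb: "(E has_derivative L y) (at y)"
  by (rule has_derivative_compose[OF bounded_linear_imp_has_derivative[OF bounded_linear_lin_comb]
        has_derivative_matrix_exponential])

lemma trace_exp_lin_comb_deriv: "trace (L y h) = trace (E y ** lin_comb A h)"
  using symmetric_matrix_has_eigenbasis[OF symmetric_lin_comb]
    trace_matrix_exp_deriv[OF symmetric_lin_comb] by blast

lemma has_derivative_partition:
  "((\<lambda>y. trace (E y)) has_derivative (\<lambda>h. trace (E y ** lin_comb A h))) (at y)"
  using bounded_linear.has_derivative[OF bounded_linear_trace has_derivative_exp_lin_comb[of y]]
  by (simp add: trace_exp_lin_comb_deriv)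

lemma has_derivative_f:
  "(f has_derivative (\<lambda>h. trace (E y ** lin_comb A h) / trace (E y) - b \<bullet> h)) (at y)"
proof -
  have "((\<lambda>y. ln (trace (E y)) - b \<bullet> y) has_derivative
      (\<lambda>h. trace (E y ** lin_comb A h) / trace (E y) - b \<bullet> h)) (at y)"
    using partition_pos[of y]
    by (auto intro!: derivative_eq_intros has_derivative_partition simp: field_simps)
  then show ?thesis by (simp add: f[abs_def])
qed

lemma gradient_f: "gradient f y = (\<chi> i. trace (E y ** A i) / trace (E y) - b $ i)"
  unfolding gradient_def frechet_derivative_at[OF has_derivative_f, symmetric]
  by (simp add: lin_comb_axis inner_axis)

definition gradient_deriv :: "real^'m \<Rightarrow> real^'m \<Rightarrow> real^'m" where
  "gradient_deriv y h = (\<chi> i. trace (L y h ** A i) / trace (E y)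
     - trace (E y ** A i) * trace (E y ** lin_comb A h) / (trace (E y))\<^sup>2)"

lemma has_derivative_gradient: "(gradient f has_derivative gradient_deriv y) (at y)"
proof (rule has_derivative_vec_componentwise)
  fix i
  have "((\<lambda>y. trace (A i ** E y)) has_derivative (\<lambda>h. trace (A i ** L y h))) (at y)"
    by (rule bounded_linear.has_derivative[OF bounded_linear_trace_mult has_derivative_exp_lin_comb])
  then have "((\<lambda>y. trace (E y ** A i)) has_derivative (\<lambda>h. trace (L y h ** A i))) (at y)"
    by (simp add: trace_mul_sym[of _ "A i"])
  then have "((\<lambda>y. trace (E y ** A i) / trace (E y) - b $ i) has_derivative
      (\<lambda>h. gradient_deriv y h $ i)) (at y)"
    using partition_pos[of y]
    by (auto intro!: derivative_eq_intros has_derivative_partition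
        simp: gradient_deriv_def power2_eq_square diff_divide_distrib)
  then show "((\<lambda>y. gradient f y $ i) has_derivative (\<lambda>h. gradient_deriv y h $ i)) (at y)"
    by (simp add: gradient_f)
qed

lemma hessian_f: "hessian f y = matrix (gradient_deriv y)"
  unfolding hessian_def frechet_derivative_at[OF has_derivative_gradient, symmetric] ..

lemma hessian_mult: "hessian f y *v v = gradient_deriv y v"
  unfolding hessian_f
  by (rule matrix_works)
    (metis has_derivative_gradient has_derivative_linear linear_matrix_vector_mul_eq)

lemma symmetric_hessian: "symmetric_matrix (hessian f y)"
  unfolding symmetric_matrix_def hessian_f
  by (simp add: vec_eq_iff transpose_def matrix_def gradient_deriv_def lin_comb_axis
      trace_matrix_exp_deriv_commute[OF symmetric_lin_comb] mult.commute)

lemma hessian_quadratic_form: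
  "v \<bullet> (hessian f y *v v) =
    trace (L y v ** lin_comb A v) / trace (E y) - (trace (E y ** lin_comb A v) / trace (E y))\<^sup>2"
proof -
  have "v \<bullet> gradient_deriv y v = (\<Sum>i\<in>UNIV. v $ i * trace (L y v ** A i)) / trace (E y)
      - (\<Sum>i\<in>UNIV. v $ i * trace (E y ** A i)) * trace (E y ** lin_comb A v) / (trace (E y))\<^sup>2"
    by (simp add: gradient_deriv_def inner_vec_def sum_divide_distrib sum_distrib_right
        right_diff_distrib sum_subtractf mult.assoc)
  then show ?thesis
    by (simp add: hessian_mult flip: trace_mult_lin_comb) (simp add: power2_eq_square)
qed

end

theorem theorem3:
  fixes A :: "'m::finite \<Rightarrow> real^'n^'n" and b :: "real^'m" and f :: "real^'m \<Rightarrow> real"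
  assumes "\<And>i. symmetric_matrix (A i)"
    and "\<And>i. trace (A i) = 0"
    and "\<And>i j. trace (A i ** A j) = (if i = j then 1 else 0)"
    and "\<And>y. f y = ln (trace (matrix_exponential (lin_comb A y))) - b \<bullet> y"
  shows "lambda_smooth (1/2) f"
proof -
  interpret log_partition A b f
    by unfold_locales (rule assms)+
  have "twice_differentiable f"
    unfolding twice_differentiable_def differentiable_def
    using has_derivative_f has_derivative_gradient by blast
  moreover have "hessian f y \<preceq>\<^sub>L (1/2) *\<^sub>R mat 1" for y
    unfolding loewner_le_def pos_semidef_def
  proof (intro conjI allI)
    show "symmetric_matrix ((1/2) *\<^sub>R mat 1 - hessian f y)"
      using symmetric_hessian[of y]
      by (auto simp: symmetric_matrix_def transpose_def vec_eq_iff mat_def)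
    fix v :: "real^'m"
    have "v \<bullet> (hessian f y *v v) \<le> (v \<bullet> v) / 2"
      unfolding hessian_quadratic_form trace_lin_comb_square[OF assms(3), symmetric]
      by (rule log_trace_exp_second_derivative_le[OF symmetric_lin_comb symmetric_lin_comb])
    then show "0 \<le> v \<bullet> (((1/2) *\<^sub>R mat 1 - hessian f y) *v v)"
      by (simp add: matrix_vector_mult_diff_rdistrib inner_diff_right
          scaleR_matrix_vector_assoc[symmetric])
  qed
  ultimately show ?thesis by (simp add: lambda_smooth_def)
qed

end
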